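(* Let $n,p,q,r$ be positive integers with $q\ge r$. Then $$ \sum_{\ell=0}^n \ell^{p}H_{\ell}^{(q,r)}=\sum_{y=0}^{p+r} b(p,r,n,y)\, H_{n}^{(q-y)}, $$ where $$ b(p,r,n,0)=\sum_{j=0}^{r-1} \hat{a}(r,0,j)\, A(p+j,n), $$ for $1\le y\le r-1$, $$ b(p,r,n,y)=\sum_{j=0}^{r-1-y} \hat{a}(r,y,j)\, A(p+j,n)-\sum_{\substack{m+t=y\\ 0 \le m\le r-1\\ 1 \le t \le p+r-m}} \ \sum_{j=\max\{0,t-p-1\}}^{r-1-m} \hat{a}(r,m,j)\, H(p+j,t), $$ and for $r\le y\le p+r$, $$ b(p,r,n,y)=-\sum_{\substack{m+t=y\\ 0 \le m\le r-1\\ 1 \le t \le p+r-m}} \ \sum_{j=\max\{0,t-p-1\}}^{r-1-m} \hat{a}(r,m,j)\, H(p+j,t). $$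
   Context: For every integer $m$ (possibly zero or negative) and $n\ge 0$, $H_n^{(m)}=\sum_{j=1}^n j^{-m}$ (so $H_0^{(m)}=0$). Generalized hyperharmonic numbers: $H_n^{(q,1)}=H_n^{(q)}$ and $H_n^{(q,r)}=\sum_{j=1}^n H_j^{(q,r-1)}$ for $r\ge 2$, $n\ge 0$. $S(k,i)$ are Stirling numbers of the second kind ($x^k=\sum_i S(k,i)x(x-1)\cdots(x-i+1)$) and $s(k,i)$ are (signed) Stirling numbers of the first kind ($x(x-1)\cdots(x-k+1)=\sum_i s(k,i)x^i$), with $S(0,0)=s(0,0)=1$. Define $A(k,n)=\sum_{i=0}^{k} S(k,i)\, i!\binom{n+1}{i+1}$ and $H(k,t)=\sum_{i=t-1}^{k}\frac{1}{i+1}S(k,i)\,s(i+1,t)$. Bernoulli numbers $B_m^{+}$ are defined by $\frac{x}{1-e^{-x}}=\sum_{m\ge0}B_m^{+}\frac{x^m}{m!}$. The numbers $\hat a(r,m,j)$, for $r\ge1$, $0\le m\le r-1$, $0\le j\le r-1-m$, are defined recursively by $\hat a(1,0,0)=1$ and, for $r\ge1$: $\hat{a}(r+1,r,0)=-\sum_{m=0}^{r-1} \hat{a}(r,m,r-m-1)\frac{1}{r-m}$; $\hat{a}(r+1,m,\ell)=\sum_{j=\ell-1}^{r-1-m} \frac{\hat{a}(r,m,j)}{j+1} \binom{j+1}{j-\ell+1}B_{j-\ell+1}^{+}$ for $0\le m\le r-1$, $1\le \ell\le r-m$; $\hat{a}(r+1,m,0)=-\sum_{y=0}^{m} \sum_{j=\max\{0,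 m-y-1\}}^{r-1-y}\hat{a}(r,y,j)D(r,m,j,y)$ for $0\le m\le r-1$, where $D(r,m,j,y)=\sum_{\ell=\max\{0, m-y-1\}}^{j} \frac{1}{j+1} \binom{j+1}{j-\ell}B_{j-\ell}^{+}\binom{\ell+1}{m-y}(-1)^{1+\ell-m+y}$. *)

theory Defs
  imports
    Complex_Main
    "HOL-Computational_Algebra.Formal_Power_Series"
    "HOL-Combinatorics.Stirling"
begin

definition gen_harm :: "int \<Rightarrow> nat \<Rightarrow> real" where
  "gen_harm m n = (\<Sum>j=1..n. real j powi (- m))"

text \<open>The order \<open>r\<close> of a hyperharmonic number starts at 1; the value at \<open>r = 0\<close> is a dummy.\<close>

primrec hyper_harm :: "int \<Rightarrow> nat \<Rightarrow> nat \<Rightarrow> real" where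
  "hyper_harm q 0 n = 0"
| "hyper_harm q (Suc r) n =
    (if r = 0 then gen_harm q n else (\<Sum>j=1..n. hyper_harm q r j))"

text \<open>
  The library's \<^const>\<open>stirling\<close> counts permutations by cycles, hence is unsigned.
  The defining identities of both kinds of Stirling numbers are
  \<open>Stirling_falling\<close> and \<open>sstirling_falling\<close> below.
\<close>

definition sstirling :: "nat \<Rightarrow> nat \<Rightarrow> real" where
  "sstirling k i = (-1) ^ (k + i) * real (stirling k i)"

lemma Stirling_falling:
  fixes x :: real
  shows "x ^ k = (\<Sum>i\<le>k. real (Stirling k i) * (\<Prod>j<i. x - real j))"
proof (induction k)
  case 0
  show ?case by simp
next
  case (Suc k)
  define P where "P i = (\<Prod>j<i. x - real j)" for i
  have P: "x * P i = P (Suc i) + real i * P i" for i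
    by (simp add: P_def algebra_simps)
  have shift: "(\<Sum>i\<le>k. real i * real (Stirling k i) * P i) =
      (\<Sum>i\<le>k. real (Suc i) * real (Stirling k (Suc i)) * P (Suc i))"
  proof -
    have "(\<Sum>i\<le>k. real i * real (Stirling k i) * P i) =
        (\<Sum>i\<le>Suc k. real i * real (Stirling k i) * P i)" by simp
    also have "\<dots> = (\<Sum>i\<le>k. real (Suc i) * real (Stirling k (Suc i)) * P (Suc i))"
      by (subst sum.atMost_Suc_shift) simp
    finally show ?thesis .
  qed
  have "x ^ Suc k = (\<Sum>i\<le>k. real (Stirling k i) * (x * P i))"
    by (simp add: Suc.IH P_def sum_distrib_left mult_ac)
  also have "\<dots> = (\<Sum>i\<le>k. real (Stirling k i) * P (Suc i)) +
      (\<Sum>i\<le>k. real i * real (Stirling k i) * P i)"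
    by (simp add: P algebra_simps sum.distrib)
  also have "\<dots> = (\<Sum>i\<le>k. real (Stirling (Suc k) (Suc i)) * P (Suc i))"
    unfolding shift by (subst sum.distrib[symmetric]) (simp add: algebra_simps)
  also have "\<dots> = (\<Sum>i\<le>Suc k. real (Stirling (Suc k) i) * P i)"
    by (subst sum.atMost_Suc_shift) simp
  finally show ?case by (simp add: P_def)
qed

lemma sstirling_falling:
  fixes x :: real
  shows "(\<Prod>j<k. x - real j) = (\<Sum>i\<le>k. sstirling k i * x ^ i)"
proof (induction k)
  case 0
  show ?case by (simp add: sstirling_def)
next
  case (Suc k)
  have shift: "(\<Sum>i\<le>k. real k * sstirling k i * x ^ i) =
      (\<Sum>i\<le>k. real k * sstirling k (Suc i) * x ^ Suc i)"
  proof -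
    have "(\<Sum>i\<le>k. real k * sstirling k i * x ^ i) =
        (\<Sum>i\<le>Suc k. real k * sstirling k i * x ^ i)" by (simp add: sstirling_def)
    also have "\<dots> = (\<Sum>i\<le>k. real k * sstirling k (Suc i) * x ^ Suc i)"
      by (subst sum.atMost_Suc_shift) (cases k; simp add: sstirling_def)
    finally show ?thesis .
  qed
  have rec: "sstirling (Suc k) (Suc i) = sstirling k i - real k * sstirling k (Suc i)" for i
    by (simp add: sstirling_def algebra_simps)
  have "(\<Prod>j<Suc k. x - real j) = (\<Sum>i\<le>k. sstirling k i * x ^ i) * (x - real k)"
    by (simp add: Suc.IH)
  also have "\<dots> = (\<Sum>i\<le>k. sstirling k i * x ^ Suc i) - (\<Sum>i\<le>k. real k * sstirling k i * x ^ i)"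
    by (simp add: sum_distrib_right sum_distrib_left algebra_simps sum_subtractf)
  also have "\<dots> = (\<Sum>i\<le>k. sstirling (Suc k) (Suc i) * x ^ Suc i)"
    by (simp only: shift rec left_diff_distrib sum_subtractf)
  also have "\<dots> = (\<Sum>i\<le>Suc k. sstirling (Suc k) i * x ^ i)"
    by (subst sum.atMost_Suc_shift) (simp add: sstirling_def)
  finally show ?case .
qed

definition A_num :: "nat \<Rightarrow> nat \<Rightarrow> real" where
  "A_num k n = (\<Sum>i=0..k. real (Stirling k i) * fact i * real ((n + 1) choose (i + 1)))"

definition H_num :: "nat \<Rightarrow> nat \<Rightarrow> real" where
  "H_num k t = (\<Sum>i=t-1..k. 1 / real (i + 1) * real (Stirling k i) * sstirling (i + 1) t)"

definition bernoulli_plus :: "nat \<Rightarrow> real" where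
  "bernoulli_plus m = fact m * fps_nth (fps_X / (1 - fps_exp (-1))) m"

lemma bernoulli_plus_egf:
  "Abs_fps (\<lambda>m. bernoulli_plus m / fact m) * (1 - fps_exp (-1)) = fps_X"
proof -
  have nz: "fps_nth (1 - fps_exp (-1 :: real)) 1 \<noteq> 0"
    by simp
  have "subdegree (1 - fps_exp (-1 :: real)) = 1"
    by (rule subdegreeI[OF nz]) simp
  then have "(1 - fps_exp (-1 :: real)) dvd fps_X"
    by (subst fps_dvd_iff) (use nz in auto)
  then show ?thesis
    by (simp add: bernoulli_plus_def fps_nth_inverse)
qed

text \<open>
  Subtractions of naturals below are arranged so that they either cannot truncate on the range
  where they are used, or are lower summation limits in which truncation is exactly
  \<open>max {0, \<dots>}\<close>.
\<close>

definition D_num :: "nat \<Rightarrow> nat \<Rightarrow> nat \<Rightarrow> nat \<Rightarrow> real" where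
  "D_num r m j y = (\<Sum>l=m-y-1..j. 1 / real (j + 1) * real ((j + 1) choose (j - l)) *
     bernoulli_plus (j - l) * real ((l + 1) choose (m - y)) * (-1) ^ (1 + l + y - m))"

text \<open>Values outside \<open>1 \<le> r\<close>, \<open>m \<le> r - 1\<close>, \<open>l \<le> r - 1 - m\<close> are dummies.\<close>

primrec a_hat :: "nat \<Rightarrow> nat \<Rightarrow> nat \<Rightarrow> real" where
  "a_hat 0 m l = 0"
| "a_hat (Suc r) m l =
    (if r = 0 then (if m = 0 \<and> l = 0 then 1 else 0)
     else if m = r \<and> l = 0 then
       - (\<Sum>k=0..r-1. a_hat r k (r - k - 1) * (1 / real (r - k)))
     else if m \<le> r - 1 \<and> 1 \<le> l \<and> l \<le> r - m then
       (\<Sum>j=l-1..r-1-m. a_hat r m j / real (j + 1) * real ((j + 1) choose (j + 1 - l)) *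
          bernoulli_plus (j + 1 - l))
     else if m \<le> r - 1 \<and> l = 0 then
       - (\<Sum>y=0..m. \<Sum>j=m-y-1..r-1-y. a_hat r y j * D_num r m j y)
     else 0)"

definition bH_sum :: "nat \<Rightarrow> nat \<Rightarrow> nat \<Rightarrow> real" where
  "bH_sum p r y =
     (\<Sum>(m, t) \<in> {(m, t). m + t = y \<and> 0 \<le> m \<and> m \<le> r - 1 \<and> 1 \<le> t \<and> t \<le> p + r - m}.
        \<Sum>j=t-p-1..r-1-m. a_hat r m j * H_num (p + j) t)"

definition b_coeff :: "nat \<Rightarrow> nat \<Rightarrow> nat \<Rightarrow> nat \<Rightarrow> real" where
  "b_coeff p r n y =
     (if y = 0 then (\<Sum>j=0..r-1. a_hat r 0 j * A_num (p + j) n)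
      else if y \<le> r - 1 then (\<Sum>j=0..r-1-y. a_hat r y j * A_num (p + j) n) - bH_sum p r y
      else - bH_sum p r y)"

end

theory Submission
  imports Defs
begin

text \<open>
  Write \<open>h(q,n)\<close> for \<open>gen_harm q n\<close>. If \<open>F\<close> is a primitive of \<open>l^k\<close>, summation by parts turns
  \<open>\<Sum>l\<le>n. l^k * h(q,l)\<close> into \<open>F(n) * h(q,n)\<close> minus a combination of the \<open>h(q-t,n)\<close> whose
  coefficients are those of the polynomial \<open>F(k-1)\<close> in \<open>k\<close>. With the Bernoulli form of the power
  sum as \<open>F\<close>, induction on \<open>r\<close> expands the hyperharmonic number of order \<open>r\<close> in the
  \<open>n^j * h(q-m,n)\<close>, with coefficients \<open>a_hat r m j\<close>. Multiplying by \<open>l^p\<close> and summing once more,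
  now with the Stirling form of the power sum as \<open>F\<close>, gives the theorem.
\<close>

section \<open>Summation by parts\<close>

lemma gen_harm_0 [simp]: "gen_harm q 0 = 0"
  by (simp add: gen_harm_def)

lemma gen_harm_Suc: "gen_harm q (Suc n) = gen_harm q n + real (Suc n) powi (- q)"
  by (simp add: gen_harm_def)

text \<open>The boundary term at 0 vanishes because \<open>gen_harm q 0 = 0\<close>, whatever the
  value \<open>F 0\<close>.\<close>

lemma sum_by_parts_gen_harm:
  fixes F :: "nat \<Rightarrow> real"
  shows "(\<Sum>l=1..n. (F l - F (l - 1)) * gen_harm q l) =
    F n * gen_harm q n - (\<Sum>k=1..n. F (k - 1) * real k powi (- q))"
  by (induction n) (simp_all add: gen_harm_Suc algebra_simps)

lemma sum_power_powi_eq_gen_harm: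
  "(\<Sum>k=1..n. real k ^ t * real k powi (- q)) = gen_harm (q - int t) n"
  unfolding gen_harm_def
proof (rule sum.cong)
  fix k assume "k \<in> {1..n}"
  then have "real k powi (int t + - q) = real k powi int t * real k powi (- q)"
    by (intro power_int_add) auto
  then show "real k ^ t * real k powi (- q) = real k powi (- (q - int t))"
    by simp
qed simp

text \<open>\<open>poly\<close> uses powers of \<open>Suc k\<close> because summation by parts
  evaluates \<open>F\<close> at \<open>k - 1\<close>; a factor \<open>k ^ t\<close> then lowers the
  order \<open>q\<close> by \<open>t\<close>.\<close>

lemma sum_mult_gen_harm:
  fixes F f d :: "nat \<Rightarrow> real"
  assumes diff: "\<And>l. F (Suc l) - F l = f (Suc l)"
    and poly: "\<And>k. F k = (\<Sum>t\<in>T. d t * real (Suc k) ^ t)"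
  shows "(\<Sum>l=1..n. f l * gen_harm q l) =
    F n * gen_harm q n - (\<Sum>t\<in>T. d t * gen_harm (q - int t) n)"
proof -
  have f: "f l = F l - F (l - 1)" if "l \<in> {1..n}" for l
    using diff[of "l - 1"] that by simp
  have F: "F (k - 1) = (\<Sum>t\<in>T. d t * real k ^ t)" if "k \<in> {1..n}" for k
    using poly[of "k - 1"] that by simp
  have "(\<Sum>k=1..n. F (k - 1) * real k powi (- q)) =
      (\<Sum>k=1..n. \<Sum>t\<in>T. d t * (real k ^ t * real k powi (- q)))"
    by (intro sum.cong refl) (simp only: F sum_distrib_right mult.assoc)
  also have "\<dots> = (\<Sum>t\<in>T. d t * gen_harm (q - int t) n)"
    by (subst sum.swap) (simp only: sum_distrib_left[symmetric] sum_power_powi_eq_gen_harm)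
  finally have "(\<Sum>k=1..n. F (k - 1) * real k powi (- q)) =
    (\<Sum>t\<in>T. d t * gen_harm (q - int t) n)" .
  then show ?thesis
    using sum_by_parts_gen_harm[of F q n] f by simp
qed


section \<open>Power sums via Stirling numbers\<close>

lemma fact_binomial_eq_falling:
  "fact i * real (n choose i) = (\<Prod>j<i. real n - real j)"
  by (simp add: binomial_gbinomial gbinomial_prod_rev atLeast0LessThan)

lemma power_eq_sum_Stirling_binomial:
  "real n ^ k = (\<Sum>i=0..k. real (Stirling k i) * fact i * real (n choose i))"
  by (simp add: Stirling_falling[of "real n" k] fact_binomial_eq_falling[symmetric]
      atLeast0AtMost mult.assoc)

text \<open>By Pascal's rule the binomials with lower index \<open>i + 1\<close> differ by
  \<open>Suc n choose i\<close>, which leaves the falling factorial expansion of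
  \<open>Suc n ^ k\<close>.\<close>

lemma A_num_diff: "A_num k (Suc n) - A_num k n = real (Suc n) ^ k"
  unfolding A_num_def power_eq_sum_Stirling_binomial sum_subtractf[symmetric]
  by (intro sum.cong) (simp_all add: algebra_simps)

lemma H_num_eq_0: "k + 1 < t \<Longrightarrow> H_num k t = 0"
  by (simp add: H_num_def)

text \<open>\<open>fact i * (Suc n choose Suc i)\<close> is the falling factorial of
  \<open>Suc n\<close> of length \<open>i + 1\<close>, divided by \<open>i + 1\<close>; Stirling
  numbers of the first kind expand it in powers of \<open>Suc n\<close>.\<close>

lemma A_num_eq_sum_H_num: "A_num k n = (\<Sum>t=1..k+1. H_num k t * real (Suc n) ^ t)"
proof -
  have s0: "sstirling (Suc i) 0 = 0" for i
    by (simp add: sstirling_def)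
  have s1: "sstirling (Suc i) t = 0" if "i < t - 1" for i t
    using that by (simp add: sstirling_def)
  have H: "H_num k t = (\<Sum>i\<le>k. 1 / real (i + 1) * real (Stirling k i) * sstirling (i + 1) t)" for t
    unfolding H_num_def by (rule sum.mono_neutral_left) (auto simp: s1)
  have fall: "fact i * real (Suc n choose Suc i) =
      (\<Sum>t=1..k+1. 1 / real (i + 1) * sstirling (i + 1) t * real (Suc n) ^ t)" if "i \<le> k" for i
  proof -
    have "real (i + 1) * (fact i * real (Suc n choose Suc i)) =
        fact (Suc i) * real (Suc n choose Suc i)"
      by simp
    also have "\<dots> = (\<Sum>t\<le>Suc i. sstirling (Suc i) t * real (Suc n) ^ t)"
      by (simp only: fact_binomial_eq_falling sstirling_falling)
    also have "\<dots> = (\<Sum>t=1..k+1. sstirling (Suc i) t * real (Suc n) ^ t)"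
      using that by (intro sum.mono_neutral_cong) (auto simp: s0 s1 not_le Suc_le_eq)
    finally show ?thesis
      by (simp add: sum_divide_distrib[symmetric] field_simps)
  qed
  have "A_num k n = (\<Sum>i\<le>k. real (Stirling k i) * (fact i * real (Suc n choose Suc i)))"
    by (simp add: A_num_def atLeast0AtMost mult.assoc)
  also have "\<dots> = (\<Sum>i\<le>k. \<Sum>t=1..k+1.
      1 / real (i + 1) * real (Stirling k i) * sstirling (i + 1) t * real (Suc n) ^ t)"
    by (intro sum.cong refl) (simp only: fall atMost_iff sum_distrib_left mult_ac)
  also have "\<dots> = (\<Sum>t=1..k+1. H_num k t * real (Suc n) ^ t)"
    by (subst sum.swap) (simp only: H sum_distrib_right)
  finally show ?thesis .
qed

lemma sum_power_gen_harm_Stirling: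
  "(\<Sum>l=1..n. real l ^ k * gen_harm q l) =
    A_num k n * gen_harm q n - (\<Sum>t=1..k+1. H_num k t * gen_harm (q - int t) n)"
  by (rule sum_mult_gen_harm) (rule A_num_diff, rule A_num_eq_sum_H_num)


section \<open>Power sums via Bernoulli numbers\<close>

definition faulhaber_coeff :: "nat \<Rightarrow> nat \<Rightarrow> real" where
  "faulhaber_coeff j l =
    1 / real (j + 1) * real ((j + 1) choose (j - l)) * bernoulli_plus (j - l)"

text \<open>The polynomial with value 1^j + ... + n^j at each natural n; the convention B_1 = +1/2
  includes the last term.\<close>

definition faulhaber :: "nat \<Rightarrow> real \<Rightarrow> real" where
  "faulhaber j x = (\<Sum>l\<le>j. faulhaber_coeff j l * x ^ (l + 1))"

text \<open>The product generates the Bernoulli polynomials at \<open>x + 1\<close>. The summand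
  free of \<open>x\<close> is split off, since it cancels in differences.\<close>

lemma bernoulli_poly_nth:
  fixes x :: real
  shows "fps_nth (Abs_fps (\<lambda>m. bernoulli_plus m / fact m) * fps_exp x) (Suc j) =
    (bernoulli_plus (Suc j) / fact (Suc j)) + faulhaber j x / fact j"
proof -
  have "fps_nth (Abs_fps (\<lambda>m. bernoulli_plus m / fact m) * fps_exp x) (Suc j) =
      (\<Sum>i\<le>Suc j. bernoulli_plus i / fact i * (x ^ (Suc j - i) / fact (Suc j - i)))"
    by (simp add: fps_mult_nth atLeast0AtMost)
  also have "\<dots> = bernoulli_plus (Suc j) / fact (Suc j) +
      (\<Sum>i\<le>j. bernoulli_plus i / fact i * (x ^ (Suc j - i) / fact (Suc j - i)))"
    by simp
  also have "(\<Sum>i\<le>j. bernoulli_plus i / fact i * (x ^ (Suc j - i) / fact (Suc j - i))) =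
      (\<Sum>l\<le>j. bernoulli_plus (j - l) / fact (j - l) * (x ^ (l + 1) / fact (l + 1)))"
    by (rule sum.reindex_bij_witness[of _ "\<lambda>l. j - l" "\<lambda>l. j - l"]) (auto simp: Suc_diff_le)
  also have "\<dots> = faulhaber j x / fact j"
    unfolding faulhaber_def sum_divide_distrib
  proof (rule sum.cong)
    fix l assume "l \<in> {..j}"
    then have "real (Suc j choose (j - l)) = fact (Suc j) / (fact (j - l) * fact (Suc l))"
      by (subst binomial_fact) (auto simp: Suc_diff_le)
    then show "bernoulli_plus (j - l) / fact (j - l) * (x ^ (l + 1) / fact (l + 1)) =
        faulhaber_coeff j l * x ^ (l + 1) / fact j"
      by (simp add: faulhaber_coeff_def field_simps del: binomial_Suc_Suc of_nat_Suc)
  qed simp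
  finally show ?thesis .
qed

text \<open>Compare coefficients in \<open>B(X) (1 - exp (-X)) exp (xX) = X exp (xX)\<close>.\<close>

lemma faulhaber_diff: "faulhaber j x - faulhaber j (x - 1) = x ^ j"
proof -
  let ?B = "Abs_fps (\<lambda>m. bernoulli_plus m / fact m)"
  have e: "fps_exp (-1) * fps_exp x = fps_exp (x - 1)"
    by (simp add: fps_exp_add_mult[symmetric])
  have "?B * fps_exp x - ?B * fps_exp (x - 1) = (?B * (1 - fps_exp (-1))) * fps_exp x"
    unfolding e[symmetric] by (simp add: algebra_simps)
  also have "\<dots> = fps_X * fps_exp x"
    by (simp only: bernoulli_plus_egf)
  finally have "fps_nth (?B * fps_exp x - ?B * fps_exp (x - 1)) (Suc j) = x ^ j / fact j"
    by simp
  then have "(faulhaber j x - faulhaber j (x - 1)) / fact j = x ^ j / fact j"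
    unfolding fps_sub_nth bernoulli_poly_nth by (simp add: diff_divide_distrib)
  then show ?thesis by simp
qed

text \<open>The coefficient of \<open>(x + 1) ^ t\<close> in \<open>faulhaber j x\<close>, found by
  expanding powers of \<open>x = (x + 1) - 1\<close>.\<close>

definition shifted_faulhaber_coeff :: "nat \<Rightarrow> nat \<Rightarrow> real" where
  "shifted_faulhaber_coeff j t =
    (\<Sum>l=t-1..j. faulhaber_coeff j l * real ((l + 1) choose t) * (-1) ^ (1 + l - t))"

lemma D_num_eq:
  assumes "y \<le> m"
  shows "D_num r m j y = shifted_faulhaber_coeff j (m - y)"
  using assms by (simp add: D_num_def shifted_faulhaber_coeff_def faulhaber_coeff_def)

lemma shifted_faulhaber_coeff_eq_0: "j + 1 < t \<Longrightarrow> shifted_faulhaber_coeff j t = 0"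
  by (simp add: shifted_faulhaber_coeff_def)

text \<open>Only \<open>l = j\<close> contributes, giving the leading coefficient: the source of the
  factors \<open>1 / real (r - k)\<close> in \<open>a_hat\<close>.\<close>

lemma shifted_faulhaber_coeff_top: "shifted_faulhaber_coeff j (Suc j) = 1 / real (j + 1)"
proof -
  \<comment> \<open>Compare the coefficients of X in the generating function identity.\<close>
  have "bernoulli_plus 0 = 1"
    using arg_cong[OF bernoulli_plus_egf, of "\<lambda>f. fps_nth f 1"]
    by (simp add: fps_mult_nth)
  then show ?thesis
    by (simp add: shifted_faulhaber_coeff_def faulhaber_coeff_def)
qed

lemma faulhaber_shift:
  "faulhaber j x = (\<Sum>t\<le>j+1. shifted_faulhaber_coeff j t * (x + 1) ^ t)"
proof -
  \<comment> \<open>The added terms with \<open>l + 1 < t\<close> vanish with the binomial, so the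
    truncated exponent there is harmless.\<close>
  have D: "shifted_faulhaber_coeff j t =
      (\<Sum>l\<le>j. faulhaber_coeff j l * real ((l + 1) choose t) * (-1) ^ (1 + l - t))" for t
    unfolding shifted_faulhaber_coeff_def
    by (rule sum.mono_neutral_left) (auto simp: binomial_eq_0)
  have bin: "x ^ (l + 1) =
      (\<Sum>t\<le>j+1. real ((l + 1) choose t) * (x + 1) ^ t * (-1) ^ (1 + l - t))" if "l \<le> j" for l
  proof -
    have "x ^ (l + 1) = ((x + 1) + (-1)) ^ (l + 1)"
      by simp
    also have "\<dots> = (\<Sum>t\<le>l+1. real ((l + 1) choose t) * (x + 1) ^ t * (-1) ^ (l + 1 - t))"
      by (rule binomial_ring)
    also have "\<dots> = (\<Sum>t\<le>j+1. real ((l + 1) choose t) * (x + 1) ^ t * (-1) ^ (1 + l - t))"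
      using that by (intro sum.mono_neutral_cong_left) (auto simp: binomial_eq_0)
    finally show ?thesis .
  qed
  have "faulhaber j x = (\<Sum>l\<le>j. \<Sum>t\<le>j+1.
      faulhaber_coeff j l * real ((l + 1) choose t) * (-1) ^ (1 + l - t) * (x + 1) ^ t)"
    unfolding faulhaber_def
    by (intro sum.cong refl) (simp only: bin atMost_iff sum_distrib_left mult_ac)
  also have "\<dots> = (\<Sum>t\<le>j+1. shifted_faulhaber_coeff j t * (x + 1) ^ t)"
    by (subst sum.swap) (simp only: D sum_distrib_right)
  finally show ?thesis .
qed

lemma sum_power_gen_harm_faulhaber:
  "(\<Sum>l=1..n. real l ^ j * gen_harm q l) =
    faulhaber j (real n) * gen_harm q n -
    (\<Sum>t\<le>j+1. shifted_faulhaber_coeff j t * gen_harm (q - int t) n)"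
proof (rule sum_mult_gen_harm)
  show "faulhaber j (real (Suc l)) - faulhaber j (real l) = real (Suc l) ^ j" for l
    using faulhaber_diff[of j "real (Suc l)"] by simp
  show "faulhaber j (real k) =
      (\<Sum>t\<le>j+1. shifted_faulhaber_coeff j t * real (Suc k) ^ t)" for k
    by (simp only: faulhaber_shift of_nat_Suc add.commute)
qed


section \<open>Expansion of hyperharmonic numbers\<close>

text \<open>Positive powers of \<open>n\<close> stem from the boundary terms
  \<open>faulhaber j n\<close> of the summation by parts; the sum collects
  \<open>n ^ Suc l\<close>.\<close>

lemma a_hat_Suc_Suc:
  assumes "r \<ge> 1" and "m < r" and "l < r - m"
  shows "a_hat (Suc r) m (Suc l) = (\<Sum>j=l..<r-m. a_hat r m j * faulhaber_coeff j l)"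
proof -
  have "{l..r-1-m} = {l..<r-m}"
    using assms by auto
  moreover have "Suc l \<le> r - m" "m \<le> r - 1" "r \<noteq> 0" "m \<noteq> r"
    using assms by auto
  ultimately show ?thesis
    by (simp add: faulhaber_coeff_def mult.assoc)
qed

text \<open>The two recursion clauses for index 0 become one: each \<open>y\<close> contributes to
  order \<open>q - m\<close> through the shift \<open>t = m - y\<close> of the subtracted
  sum.\<close>

lemma a_hat_Suc_0:
  assumes "r \<ge> 1" and "m \<le> r"
  shows "a_hat (Suc r) m 0 =
    - (\<Sum>y\<le>m. \<Sum>j<r-y. a_hat r y j * shifted_faulhaber_coeff j (m - y))"
proof (cases "m = r")
  case True
  \<comment> \<open>The degree \<open>j + 1\<close> reaches \<open>r - y\<close> only for
    \<open>j = r - y - 1\<close>.\<close>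
  have "(\<Sum>j<r-y. a_hat r y j * shifted_faulhaber_coeff j (r - y)) =
      a_hat r y (r - y - 1) * (1 / real (r - y))" if "y < r" for y
  proof -
    have "(\<Sum>j<r-y. a_hat r y j * shifted_faulhaber_coeff j (r - y)) =
        (\<Sum>j\<in>{r-y-1}. a_hat r y j * shifted_faulhaber_coeff j (r - y))"
      using that by (intro sum.mono_neutral_right)
        (auto simp: shifted_faulhaber_coeff_eq_0)
    then show ?thesis
      using that shifted_faulhaber_coeff_top[of "r - y - 1"] by (simp add: Suc_diff_Suc)
  qed
  then have "(\<Sum>y\<le>r. \<Sum>j<r-y. a_hat r y j * shifted_faulhaber_coeff j (r - y)) =
      (\<Sum>y=0..r-1. a_hat r y (r - y - 1) * (1 / real (r - y)))"
    using assms by (intro sum.mono_neutral_cong_right) auto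
  then show ?thesis
    using True assms by simp
next
  case False
  then have "m < r"
    using assms by simp
  have "(\<Sum>j=m-y-1..r-1-y. a_hat r y j * D_num r m j y) =
      (\<Sum>j<r-y. a_hat r y j * shifted_faulhaber_coeff j (m - y))" if "y \<le> m" for y
    using that \<open>m < r\<close>
    by (intro sum.mono_neutral_cong_left) (auto simp: D_num_eq shifted_faulhaber_coeff_eq_0)
  then show ?thesis
    using False \<open>m < r\<close> by (simp add: atLeast0AtMost)
qed

lemma sum_triangle_swap:
  fixes g :: "nat \<Rightarrow> nat \<Rightarrow> 'a :: comm_monoid_add"
  shows "(\<Sum>l<N. \<Sum>j=l..<N. g j l) = (\<Sum>j<N. \<Sum>l\<le>j. g j l)"
  by (simp add: sum.Sigma,
      rule sum.reindex_bij_witness[of _ "\<lambda>(j, l). (l, j)" "\<lambda>(l, j). (j, l)"]) auto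

lemma sum_triangle_diff:
  fixes g :: "nat \<Rightarrow> nat \<Rightarrow> 'a :: comm_monoid_add"
  shows "(\<Sum>m\<le>r. \<Sum>y\<le>m. g y (m - y)) = (\<Sum>y\<le>r. \<Sum>t\<le>r-y. g y t)"
  by (simp add: sum.Sigma,
      rule sum.reindex_bij_witness[of _ "\<lambda>(y, t). (y + t, y)" "\<lambda>(m, y). (y, m - y)"]) auto

lemma hyper_harm_expansion:
  assumes "r \<ge> 1"
  shows "hyper_harm q r n =
    (\<Sum>m<r. \<Sum>j<r-m. a_hat r m j * (real n ^ j * gen_harm (q - int m) n))"
  using assms
proof (induction r arbitrary: n rule: nat_induct_at_least)
  case base
  show ?case by simp
next
  case (Suc r)
  let ?h = "\<lambda>m. gen_harm (q - int m) n"
  let ?D = shifted_faulhaber_coeff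
  have "hyper_harm q (Suc r) n = (\<Sum>l=1..n. hyper_harm q r l)"
    using Suc.hyps by simp
  also have "\<dots> = (\<Sum>m<r. \<Sum>l=1..n. \<Sum>j<r-m.
      a_hat r m j * (real l ^ j * gen_harm (q - int m) l))"
    unfolding Suc.IH by (rule sum.swap)
  also have "\<dots> = (\<Sum>m<r. \<Sum>j<r-m. \<Sum>l=1..n.
      a_hat r m j * (real l ^ j * gen_harm (q - int m) l))"
    by (intro sum.cong refl sum.swap)
  also have "\<dots> = (\<Sum>m<r. \<Sum>j<r-m. a_hat r m j *
      (faulhaber j (real n) * ?h m - (\<Sum>t\<le>j+1. ?D j t * ?h (m + t))))"
    by (simp only: sum_distrib_left[symmetric] sum_power_gen_harm_faulhaber of_nat_add
        diff_diff_eq)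
  also have "\<dots> = (\<Sum>m<r. \<Sum>j<r-m. a_hat r m j * (faulhaber j (real n) * ?h m)) -
      (\<Sum>m<r. \<Sum>j<r-m. a_hat r m j * (\<Sum>t\<le>j+1. ?D j t * ?h (m + t)))"
    by (simp add: right_diff_distrib sum_subtractf)
  \<comment> \<open>The boundary terms supply the new coefficients of positive index.\<close>
  also have "(\<Sum>m<r. \<Sum>j<r-m. a_hat r m j * (faulhaber j (real n) * ?h m)) =
      (\<Sum>m<r. \<Sum>l<r-m. a_hat (Suc r) m (Suc l) * (real n ^ Suc l * ?h m))"
  proof (rule sum.cong)
    fix m assume m: "m \<in> {..<r}"
    have "(\<Sum>l<r-m. a_hat (Suc r) m (Suc l) * (real n ^ Suc l * ?h m)) =
        (\<Sum>l<r-m. \<Sum>j=l..<r-m. a_hat r m j * (faulhaber_coeff j l * real n ^ Suc l * ?h m))"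
      using m Suc.hyps
      by (intro sum.cong refl) (simp add: a_hat_Suc_Suc sum_distrib_left mult_ac del: a_hat.simps)
    also have "\<dots> = (\<Sum>j<r-m. \<Sum>l\<le>j. a_hat r m j * (faulhaber_coeff j l * real n ^ Suc l * ?h m))"
      by (rule sum_triangle_swap)
    also have "\<dots> = (\<Sum>j<r-m. a_hat r m j * (faulhaber j (real n) * ?h m))"
      by (simp add: faulhaber_def sum_distrib_left sum_distrib_right)
    finally show "(\<Sum>j<r-m. a_hat r m j * (faulhaber j (real n) * ?h m)) =
        (\<Sum>l<r-m. a_hat (Suc r) m (Suc l) * (real n ^ Suc l * ?h m))" ..
  qed simp
  \<comment> \<open>The subtracted sums carry no power of \<open>n\<close> and supply index
    0.\<close>
  also have "(\<Sum>m<r. \<Sum>j<r-m. a_hat r m j * (\<Sum>t\<le>j+1. ?D j t * ?h (m + t))) =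
      - (\<Sum>m\<le>r. a_hat (Suc r) m 0 * ?h m)"
  proof -
    have "- (\<Sum>m\<le>r. a_hat (Suc r) m 0 * ?h m) =
        (\<Sum>m\<le>r. \<Sum>y\<le>m. \<Sum>j<r-y. a_hat r y j * (?D j (m - y) * ?h (y + (m - y))))"
      unfolding sum_negf[symmetric] using Suc.hyps
      by (intro sum.cong refl) (simp add: a_hat_Suc_0 sum_distrib_left mult_ac del: a_hat.simps)
    also have "\<dots> = (\<Sum>y\<le>r. \<Sum>t\<le>r-y. \<Sum>j<r-y. a_hat r y j * (?D j t * ?h (y + t)))"
      by (rule sum_triangle_diff)
    also have "\<dots> = (\<Sum>y\<le>r. \<Sum>j<r-y. \<Sum>t\<le>r-y. a_hat r y j * (?D j t * ?h (y + t)))"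
      by (intro sum.cong refl sum.swap)
    also have "\<dots> = (\<Sum>y<r. \<Sum>j<r-y. \<Sum>t\<le>r-y. a_hat r y j * (?D j t * ?h (y + t)))"
      by (intro sum.mono_neutral_right) auto
    also have "\<dots> = (\<Sum>y<r. \<Sum>j<r-y. \<Sum>t\<le>j+1. a_hat r y j * (?D j t * ?h (y + t)))"
      by (intro sum.cong refl sum.mono_neutral_right)
        (auto simp: shifted_faulhaber_coeff_eq_0)
    finally show ?thesis
      by (simp only: sum_distrib_left)
  qed
  also have "(\<Sum>m<r. \<Sum>l<r-m. a_hat (Suc r) m (Suc l) * (real n ^ Suc l * ?h m)) -
        - (\<Sum>m\<le>r. a_hat (Suc r) m 0 * ?h m) =
      (\<Sum>m\<le>r. a_hat (Suc r) m 0 * ?h m +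
        (\<Sum>l<r-m. a_hat (Suc r) m (Suc l) * (real n ^ Suc l * ?h m)))"
    by (simp add: sum.distrib lessThan_Suc_atMost[symmetric] del: a_hat.simps)
  \<comment> \<open>\<open>Suc r - m\<close> is \<open>Suc (r - m)\<close>, so the summand
    \<open>j = 0\<close> splits off; for \<open>m = r\<close> it is the only one.\<close>
  also have "\<dots> = (\<Sum>m<Suc r. \<Sum>j<Suc r-m. a_hat (Suc r) m j * (real n ^ j * ?h m))"
    unfolding lessThan_Suc_atMost
    by (intro sum.cong refl)
      (simp add: Suc_diff_le sum.lessThan_Suc_shift del: a_hat.simps sum.lessThan_Suc)
  finally show ?case .
qed


section \<open>The weighted sum\<close>

text \<open>Merges the three cases: \<open>bH_sum\<close> is empty at \<open>y = 0\<close> because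
  \<open>t \<ge> 1\<close>, and the \<open>A_num\<close> sum is empty for
  \<open>y \<ge> r\<close>.\<close>

lemma b_coeff_eq:
  assumes "r \<ge> 1"
  shows "b_coeff p r n y = (\<Sum>j<r-y. a_hat r y j * A_num (p + j) n) - bH_sum p r y"
proof -
  have 0: "bH_sum p r 0 = 0"
    unfolding bH_sum_def by (rule sum.neutral) auto
  have "{0..r-1-y} = {..<r-y}" if "y \<le> r - 1"
    using that assms by auto
  moreover have "{0..r-1} = {..<r}"
    using assms by auto
  moreover have "r - y = 0" if "\<not> y \<le> r - 1"
    using that by simp
  ultimately show ?thesis
    by (auto simp: b_coeff_def 0)
qed

text \<open>The pairs \<open>(m, t)\<close> are grouped by \<open>m + t = y\<close>; summing over
  all \<open>y\<close> removes this constraint.\<close>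

lemma sum_bH_sum:
  fixes h :: "nat \<Rightarrow> real"
  assumes "r \<ge> 1"
  shows "(\<Sum>y\<le>p+r. bH_sum p r y * h y) =
    (\<Sum>m<r. \<Sum>j<r-m. \<Sum>t=1..p+j+1. a_hat r m j * (H_num (p + j) t * h (m + t)))"
proof -
  define T where "T = (SIGMA m:{..<r}. {1..p+r-m})"
  define g where "g = (\<lambda>(m, t). \<Sum>j<r-m. a_hat r m j * (H_num (p + j) t * h (m + t)))"
  have bH: "bH_sum p r y * h y = sum g {x \<in> T. fst x + snd x = y}" for y
  proof -
    have "{(m, t). m + t = y \<and> 0 \<le> m \<and> m \<le> r - 1 \<and> 1 \<le> t \<and> t \<le> p + r - m} =
        {x \<in> T. fst x + snd x = y}"
      using assms by (auto simp: T_def)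
    \<comment> \<open>Indices \<open>j\<close> below \<open>t - p - 1\<close> add nothing, as
      \<open>H_num (p + j) t = 0\<close> there.\<close>
    moreover have "(\<Sum>j=t-p-1..r-1-m. a_hat r m j * H_num (p + j) t) * h y = g (m, t)"
      if "(m, t) \<in> T" "m + t = y" for m t
      unfolding g_def sum_distrib_right prod.case using that
      by (intro sum.mono_neutral_cong_left) (auto simp: T_def H_num_eq_0)
    ultimately show ?thesis
      unfolding bH_sum_def by (subst sum_distrib_right, intro sum.cong) auto
  qed
  have "finite T"
    by (simp add: T_def)
  \<comment> \<open>The groups exhaust \<open>T\<close> since \<open>m + t \<le> p + r\<close> on
    it.\<close>
  then have "(\<Sum>y\<le>p+r. bH_sum p r y * h y) = sum g T"
    unfolding bH by (intro sum.group) (auto simp: T_def)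
  also have "\<dots> = (\<Sum>m<r. \<Sum>t=1..p+r-m. \<Sum>j<r-m. a_hat r m j * (H_num (p + j) t * h (m + t)))"
    unfolding T_def g_def by (rule sum.Sigma[symmetric]) auto
  also have "\<dots> = (\<Sum>m<r. \<Sum>j<r-m. \<Sum>t=1..p+r-m. a_hat r m j * (H_num (p + j) t * h (m + t)))"
    by (intro sum.cong refl sum.swap)
  \<comment> \<open>\<open>j < r - m\<close> gives \<open>p + j + 1 \<le> p + r - m\<close>, and
    \<open>H_num\<close> vanishes on the excess.\<close>
  also have "\<dots> = (\<Sum>m<r. \<Sum>j<r-m. \<Sum>t=1..p+j+1. a_hat r m j * (H_num (p + j) t * h (m + t)))"
    by (intro sum.cong refl sum.mono_neutral_right) (auto simp: H_num_eq_0)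
  finally show ?thesis .
qed

theorem theorem5:
  fixes n p q r :: nat
  assumes "n \<ge> 1" and "p \<ge> 1" and "q \<ge> 1" and "r \<ge> 1" and "q \<ge> r"
  shows "(\<Sum>l=0..n. real l ^ p * hyper_harm (int q) r l) =
         (\<Sum>y=0..p+r. b_coeff p r n y * gen_harm (int q - int y) n)"
proof -
  let ?h = "\<lambda>m. gen_harm (int q - int m) n"
  \<comment> \<open>The term \<open>l = 0\<close> vanishes because \<open>p \<ge> 1\<close>.\<close>
  have "(\<Sum>l=0..n. real l ^ p * hyper_harm (int q) r l) =
      (\<Sum>l=1..n. real l ^ p * hyper_harm (int q) r l)"
    using \<open>p \<ge> 1\<close> by (simp add: sum.atLeast_Suc_atMost)
  also have "\<dots> = (\<Sum>l=1..n. \<Sum>m<r. \<Sum>j<r-m.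
      a_hat r m j * (real l ^ (p + j) * gen_harm (int q - int m) l))"
    by (simp add: hyper_harm_expansion[OF \<open>r \<ge> 1\<close>] sum_distrib_left power_add mult_ac)
  also have "\<dots> = (\<Sum>m<r. \<Sum>l=1..n. \<Sum>j<r-m.
      a_hat r m j * (real l ^ (p + j) * gen_harm (int q - int m) l))"
    by (rule sum.swap)
  also have "\<dots> = (\<Sum>m<r. \<Sum>j<r-m. \<Sum>l=1..n.
      a_hat r m j * (real l ^ (p + j) * gen_harm (int q - int m) l))"
    by (intro sum.cong refl sum.swap)
  also have "\<dots> = (\<Sum>m<r. \<Sum>j<r-m. a_hat r m j *
      (A_num (p + j) n * ?h m - (\<Sum>t=1..p+j+1. H_num (p + j) t * ?h (m + t))))"
    by (simp only: sum_distrib_left[symmetric] sum_power_gen_harm_Stirling of_nat_add diff_diff_eq)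
  also have "\<dots> = (\<Sum>m<r. (\<Sum>j<r-m. a_hat r m j * A_num (p + j) n) * ?h m) -
      (\<Sum>y\<le>p+r. bH_sum p r y * ?h y)"
    unfolding sum_bH_sum[OF \<open>r \<ge> 1\<close>]
    by (simp only: right_diff_distrib sum_subtractf sum_distrib_left sum_distrib_right mult.assoc)
  \<comment> \<open>The added summands \<open>y \<ge> r\<close> have empty inner sums.\<close>
  also have "(\<Sum>m<r. (\<Sum>j<r-m. a_hat r m j * A_num (p + j) n) * ?h m) =
      (\<Sum>y\<le>p+r. (\<Sum>j<r-y. a_hat r y j * A_num (p + j) n) * ?h y)"
    by (rule sum.mono_neutral_left) auto
  also have "\<dots> - (\<Sum>y\<le>p+r. bH_sum p r y * ?h y) = (\<Sum>y=0..p+r. b_coeff p r n y * ?h y)"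
    by (simp only: b_coeff_eq[OF \<open>r \<ge> 1\<close>] left_diff_distrib sum_subtractf atLeast0AtMost)
  finally show ?thesis .
qed

end
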